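(* Let $N$ be a timelike ruled surface of type $N_-$ in $\mathbb{R}_1^3$ with timelike striction curve $\vec c$ and curvatures $k_1,k_2$, and let $N^\beta$ be a $\beta$-transversal surface of $N$ whose striction curve $\vec c_\beta$ coincides with $\vec c$. Then $\vec c$ is a line of curvature on $N$ if and only if $$\beta'=\frac{k_1^2-k_2^2}{k_2}$$ holds on $I$.
   Context: $\mathbb{R}_1^3$ is Minkowski 3-space with metric $\langle\cdot,\cdot\rangle=-dx_1^2+dx_2^2+dx_3^2$. A nonzero vector $\vec v$ is timelike if $\langle\vec v,\vec v\rangle<0$, null if $\langle\vec v,\vec v\rangle=0$, spacelike if $\langle\vec v,\vec v\rangle>0$. Setting. All functions are smooth on an open interval $I$. A timelike ruled surface of type $N_-$ with timelike striction curve is $\vec r(s,v)=\vec c(s)+v\vec q(s)$, with ruling direction $\vec q$ unit timelike, where $\vec c$ is its striction curve, a timelike curve parametrized by arc length $s$. It has a Frenet frame $\{\vec q,\vec h,\vec a\}$ of mutually orthogonal vectors, $\langle\vec q,\vec q\rangle=-1$, $\langle\vec h,\vec h\rangle=\langle\vec a,\vec a\rangle=1$ ($\vec h$ is the central normal, i.e. the surface normal along $\vec c$; $\vec a$ the central tangent), with $\vec q\,'=k_1\vec h$, $\vec h'=k_1\vec q+k_2\vec a$, $\vec a'=-k_2\vec h$ (prime is $d/ds$) for functions $k_1,k_2$. Standing assumption: the derivatives of the frame vectors are non-null and $N$ is non-cylindrical; in particular $k_1\neq0$ and $k_1^2\neq k_2^2$ everywhere. The unit tangent of $\vec c$ is $\vec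 c\,'=\vec t=\cosh\theta\,\vec q+\sinh\theta\,\vec a$ for a real function $\theta$ (the hyperbolic angle between $\vec t$ and $\vec q$). $\beta$-transversal surface. For a function $\beta:I\to\mathbb{R}$ with $\beta(s)\neq n\pi,\ (2n+1)\pi/2$ for all $s\in I$, $n\in\mathbb{Z}$, $N^\beta$ is the ruled surface $\vec r_\beta(s,v)=\vec c(s)+v\vec q_\beta(s)$ with $\vec q_\beta=\cos\beta\,\vec h+\sin\beta\,\vec a$; it is assumed that $\langle\vec q_\beta',\vec q_\beta'\rangle\ne0$ everywhere. Its striction curve is $\vec c_\beta=\vec c+v_\beta\vec q_\beta$ with $v_\beta=-\langle\vec c\,',\vec q_\beta'\rangle/\langle\vec q_\beta',\vec q_\beta'\rangle$; it coincides with $\vec c$ if $v_\beta=0$ on $I$. The curve $\vec c$ is a line of curvature on $N$ if $\vec h'$ and $\vec t$ are linearly dependent on $I$, i.e. $\vec h'=\lambda\vec t$ for some scalar function $\lambda=\lambda(s)$. Convention: an equation containing a quotient is understood to include that its denominator is nonzero. *)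

theory Defs
  imports "HOL-Analysis.Analysis"
begin

section \<open>Minkowski 3-space\<close>

definition minkowski :: "real ^ 3 \<Rightarrow> real ^ 3 \<Rightarrow> real" where
  "minkowski x y = - (x $ 1 * y $ 1) + x $ 2 * y $ 2 + x $ 3 * y $ 3"

lemma minkowski_zero_left [simp]: "minkowski 0 y = 0"
  by (simp add: minkowski_def)

definition timelike :: "real ^ 3 \<Rightarrow> bool" where
  "timelike v \<longleftrightarrow> v \<noteq> 0 \<and> minkowski v v < 0"

text \<open>The causal characters are only attributed to nonzero vectors, so \<open>0\<close> is not null.\<close>

definition null_vector :: "real ^ 3 \<Rightarrow> bool" where
  "null_vector v \<longleftrightarrow> v \<noteq> 0 \<and> minkowski v v = 0"

text \<open>\<open>C\<^sup>\<infinity>\<close> on an open set of parameters: \<open>D n\<close> is the \<open>n\<close>-th derivative.\<close>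

definition smooth_on :: "real set \<Rightarrow> (real \<Rightarrow> 'a::real_normed_vector) \<Rightarrow> bool" where
  "smooth_on I f \<longleftrightarrow> (\<exists>D :: nat \<Rightarrow> real \<Rightarrow> 'a. D 0 = f \<and>
     (\<forall>n. \<forall>s\<in>I. (D n has_vector_derivative D (Suc n) s) (at s)))"

section \<open>Ruled surfaces\<close>

text \<open>A ruled surface is given by a base curve \<open>c\<close> and a ruling direction \<open>q\<close>.\<close>

definition ruled_surface ::
  "(real \<Rightarrow> real ^ 3) \<Rightarrow> (real \<Rightarrow> real ^ 3) \<Rightarrow> real \<Rightarrow> real \<Rightarrow> real ^ 3" where
  "ruled_surface c q s v = c s + v *\<^sub>R q s"

definition striction_parameter ::
  "(real \<Rightarrow> real ^ 3) \<Rightarrow> (real \<Rightarrow> real ^ 3) \<Rightarrow> real \<Rightarrow> real" where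
  "striction_parameter c q s =
     - minkowski (vector_derivative c (at s)) (vector_derivative q (at s)) /
       minkowski (vector_derivative q (at s)) (vector_derivative q (at s))"

definition striction_curve ::
  "(real \<Rightarrow> real ^ 3) \<Rightarrow> (real \<Rightarrow> real ^ 3) \<Rightarrow> real \<Rightarrow> real ^ 3" where
  "striction_curve c q s = ruled_surface c q s (striction_parameter c q s)"

text \<open>
  A timelike ruled surface \<open>ruled_surface c q\<close> of type \<open>N\<^sub>-\<close> whose striction curve \<open>c\<close> is timelike
  and parametrized by arc length, with Frenet frame \<open>q, h, a\<close>, curvatures \<open>k1, k2\<close> and hyperbolic
  angle \<open>\<theta>\<close>. That \<open>h\<close> is normal to the surface along \<open>c\<close>, and that the surface is timelike
  wherever it is regular, follow from these conditions.
\<close>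

locale timelike_ruled_surface_minus =
  fixes I :: "real set"
    and c q h a :: "real \<Rightarrow> real ^ 3"
    and k1 k2 \<theta> :: "real \<Rightarrow> real"
  assumes open_interval: "open I" "is_interval I" "I \<noteq> {}"
    and smooth: "smooth_on I c" "smooth_on I q" "smooth_on I h" "smooth_on I a"
      "smooth_on I k1" "smooth_on I k2" "smooth_on I \<theta>"
    and frame_norm: "\<And>s. s \<in> I \<Longrightarrow> minkowski (q s) (q s) = -1"
      "\<And>s. s \<in> I \<Longrightarrow> minkowski (h s) (h s) = 1"
      "\<And>s. s \<in> I \<Longrightarrow> minkowski (a s) (a s) = 1"
    and frame_orthogonal: "\<And>s. s \<in> I \<Longrightarrow> minkowski (q s) (h s) = 0"
      "\<And>s. s \<in> I \<Longrightarrow> minkowski (q s) (a s) = 0"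
      "\<And>s. s \<in> I \<Longrightarrow> minkowski (h s) (a s) = 0"
    and frenet: "\<And>s. s \<in> I \<Longrightarrow> (q has_vector_derivative k1 s *\<^sub>R h s) (at s)"
      "\<And>s. s \<in> I \<Longrightarrow> (h has_vector_derivative k1 s *\<^sub>R q s + k2 s *\<^sub>R a s) (at s)"
      "\<And>s. s \<in> I \<Longrightarrow> (a has_vector_derivative - k2 s *\<^sub>R h s) (at s)"
    and noncylindrical: "\<And>s. s \<in> I \<Longrightarrow> vector_derivative q (at s) \<noteq> 0"
    and frame_derivatives_nonnull:
      "\<And>s. s \<in> I \<Longrightarrow> \<not> null_vector (vector_derivative q (at s))"
      "\<And>s. s \<in> I \<Longrightarrow> \<not> null_vector (vector_derivative h (at s))"
      "\<And>s. s \<in> I \<Longrightarrow> \<not> null_vector (vector_derivative a (at s))"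
    and striction: "\<And>s. s \<in> I \<Longrightarrow> striction_curve c q s = c s"
    and timelike_curve: "\<And>s. s \<in> I \<Longrightarrow> timelike (vector_derivative c (at s))"
    and arc_length: "\<And>s. s \<in> I \<Longrightarrow>
      minkowski (vector_derivative c (at s)) (vector_derivative c (at s)) = -1"
    and tangent: "\<And>s. s \<in> I \<Longrightarrow>
      (c has_vector_derivative cosh (\<theta> s) *\<^sub>R q s + sinh (\<theta> s) *\<^sub>R a s) (at s)"
begin

lemma k1_nonzero: "s \<in> I \<Longrightarrow> k1 s \<noteq> 0"
  using noncylindrical[of s] frenet(1)[of s] by (auto simp: vector_derivative_at)

lemma curvatures_sq_distinct:
  assumes s: "s \<in> I"
  shows "(k1 s)\<^sup>2 \<noteq> (k2 s)\<^sup>2"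
proof
  assume eq: "(k1 s)\<^sup>2 = (k2 s)\<^sup>2"
  let ?d = "k1 s *\<^sub>R q s + k2 s *\<^sub>R a s"
  have "minkowski ?d ?d = (k1 s)\<^sup>2 * minkowski (q s) (q s)
      + 2 * k1 s * k2 s * minkowski (q s) (a s) + (k2 s)\<^sup>2 * minkowski (a s) (a s)"
    by (simp add: minkowski_def power2_eq_square algebra_simps)
  then have null: "minkowski ?d ?d = 0"
    using s eq by (simp add: frame_norm frame_orthogonal)
  have "minkowski ?d (q s) = k1 s * minkowski (q s) (q s) + k2 s * minkowski (q s) (a s)"
    by (simp add: minkowski_def algebra_simps)
  then have "minkowski ?d (q s) \<noteq> 0"
    using s k1_nonzero by (simp add: frame_norm frame_orthogonal)
  then have "?d \<noteq> 0"
    by (metis minkowski_zero_left)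
  with null show False
    using frame_derivatives_nonnull(2)[OF s] vector_derivative_at[OF frenet(2)[OF s]]
    by (simp add: null_vector_def)
qed

end

text \<open>The curve \<open>c\<close> is a line of curvature on the ruled surface with central normal \<open>h\<close>.\<close>

definition line_of_curvature ::
  "real set \<Rightarrow> (real \<Rightarrow> real ^ 3) \<Rightarrow> (real \<Rightarrow> real ^ 3) \<Rightarrow> bool" where
  "line_of_curvature I h c \<longleftrightarrow> (\<exists>\<mu> :: real \<Rightarrow> real. \<forall>s\<in>I.
     vector_derivative h (at s) = \<mu> s *\<^sub>R vector_derivative c (at s))"

section \<open>Transversal surfaces\<close>

definition transversal_direction ::
  "(real \<Rightarrow> real ^ 3) \<Rightarrow> (real \<Rightarrow> real ^ 3) \<Rightarrow> (real \<Rightarrow> real) \<Rightarrow> real \<Rightarrow> real ^ 3" where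
  "transversal_direction h a \<beta> s = cos (\<beta> s) *\<^sub>R h s + sin (\<beta> s) *\<^sub>R a s"

text \<open>
  The \<open>\<beta>\<close>-transversal surface is \<open>ruled_surface c (transversal_direction h a \<beta>)\<close>, for \<open>\<beta>\<close> subject
  to the following conditions.
\<close>

locale transversal_surface = timelike_ruled_surface_minus +
  fixes \<beta> :: "real \<Rightarrow> real"
  assumes smooth_angle: "smooth_on I \<beta>"
    and angle: "\<And>s n. s \<in> I \<Longrightarrow> \<beta> s \<noteq> of_int n * pi"
      "\<And>s n. s \<in> I \<Longrightarrow> \<beta> s \<noteq> (2 * of_int n + 1) * pi / 2"
    and direction_derivative_nonnull: "\<And>s. s \<in> I \<Longrightarrow>
      minkowski (vector_derivative (transversal_direction h a \<beta>) (at s))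
        (vector_derivative (transversal_direction h a \<beta>) (at s)) \<noteq> 0"

end

theory Submission
  imports Defs
begin

text \<open>
  Vanishing of the striction parameter of \<open>N\<^sup>\<beta>\<close> means \<open>\<langle>c', q\<^sub>\<beta>'\<rangle> = 0\<close>, which in the frame reads
  \<open>sinh \<theta> (\<beta>' + k\<^sub>2) = k\<^sub>1 cosh \<theta>\<close>; in particular \<open>sinh \<theta> \<noteq> 0\<close>. The curve is a line of curvature
  iff \<open>k\<^sub>1 q + k\<^sub>2 a\<close> is proportional to \<open>cosh \<theta> q + sinh \<theta> a\<close>, that is
  \<open>k\<^sub>1 sinh \<theta> = k\<^sub>2 cosh \<theta>\<close>. Eliminating \<open>\<theta>\<close> gives \<open>(\<beta>' + k\<^sub>2) k\<^sub>2 = k\<^sub>1\<^sup>2\<close>.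
\<close>

lemma minkowski_add_left: "minkowski (x + y) z = minkowski x z + minkowski y z"
  by (simp add: minkowski_def algebra_simps)

lemma minkowski_add_right: "minkowski x (y + z) = minkowski x y + minkowski x z"
  by (simp add: minkowski_def algebra_simps)

lemma minkowski_diff_right: "minkowski x (y - z) = minkowski x y - minkowski x z"
  by (simp add: minkowski_def algebra_simps)

lemma minkowski_scaleR_left: "minkowski (r *\<^sub>R x) y = r * minkowski x y"
  by (simp add: minkowski_def algebra_simps)

lemma minkowski_scaleR_right: "minkowski x (r *\<^sub>R y) = r * minkowski x y"
  by (simp add: minkowski_def algebra_simps)

lemma minkowski_commute: "minkowski x y = minkowski y x"
  by (simp add: minkowski_def mult.commute)

lemmas minkowski_bilinear =
  minkowski_add_left minkowski_add_right minkowski_diff_right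
  minkowski_scaleR_left minkowski_scaleR_right

lemma smooth_on_has_real_derivative:
  fixes f :: "real \<Rightarrow> real"
  assumes "smooth_on I f" "s \<in> I"
  shows "(f has_real_derivative deriv f s) (at s)"
proof -
  obtain D where "D 0 = f" "\<And>n s. s \<in> I \<Longrightarrow> (D n has_vector_derivative D (Suc n) s) (at s)"
    using assms(1) unfolding smooth_on_def by blast
  then have "(f has_real_derivative D 1 s) (at s)"
    using assms(2) by (metis One_nat_def has_real_derivative_iff_has_vector_derivative)
  then show ?thesis
    by (metis DERIV_imp_deriv)
qed

context timelike_ruled_surface_minus
begin

text \<open>Both orders of each mixed product are listed, so that bilinear expansions in the frame
  evaluate by rewriting alone.\<close>

lemma frame_products:
  assumes "s \<in> I"
  shows "minkowski (q s) (q s) = -1" "minkowski (h s) (h s) = 1" "minkowski (a s) (a s) = 1"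
    "minkowski (q s) (h s) = 0" "minkowski (q s) (a s) = 0" "minkowski (h s) (a s) = 0"
    "minkowski (h s) (q s) = 0" "minkowski (a s) (q s) = 0" "minkowski (a s) (h s) = 0"
  using frame_norm frame_orthogonal assms by (simp_all add: minkowski_commute)

text \<open>Both \<open>h'\<close> and \<open>c'\<close> lie in the plane of \<open>q\<close> and
  \<open>a\<close>, so their proportionality is the vanishing of a 2 by 2 determinant of
  coefficients.\<close>

lemma line_of_curvature_iff:
  "line_of_curvature I h c \<longleftrightarrow> (\<forall>s\<in>I. k1 s * sinh (\<theta> s) = k2 s * cosh (\<theta> s))"
proof
  assume "line_of_curvature I h c"
  then obtain \<mu> where
    "\<forall>s\<in>I. vector_derivative h (at s) = \<mu> s *\<^sub>R vector_derivative c (at s)"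
    unfolding line_of_curvature_def by (elim exE)
  then have \<mu>:
    "k1 s *\<^sub>R q s + k2 s *\<^sub>R a s = \<mu> s *\<^sub>R (cosh (\<theta> s) *\<^sub>R q s + sinh (\<theta> s) *\<^sub>R a s)"
    if "s \<in> I" for s
    using that by (simp add: vector_derivative_at[OF frenet(2)] vector_derivative_at[OF tangent])
  show "\<forall>s\<in>I. k1 s * sinh (\<theta> s) = k2 s * cosh (\<theta> s)"
  proof
    fix s assume s: "s \<in> I"
    \<comment> \<open>Pairing with \<open>q\<close> and then with \<open>a\<close> reads off the
      coefficients; in the first case both sides change sign.\<close>
    have "k1 s = \<mu> s * cosh (\<theta> s)"
      using arg_cong[OF \<mu>[OF s], of "\<lambda>x. minkowski x (q s)"]
      by (simp add: minkowski_bilinear frame_products[OF s])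
    moreover have "k2 s = \<mu> s * sinh (\<theta> s)"
      using arg_cong[OF \<mu>[OF s], of "\<lambda>x. minkowski x (a s)"]
      by (simp add: minkowski_bilinear frame_products[OF s])
    ultimately show "k1 s * sinh (\<theta> s) = k2 s * cosh (\<theta> s)"
      by simp
  qed
next
  assume eq: "\<forall>s\<in>I. k1 s * sinh (\<theta> s) = k2 s * cosh (\<theta> s)"
  \<comment> \<open>The factor is the ratio of the \<open>q\<close>-components, defined everywhere
    because \<open>cosh\<close> has no real zero.\<close>
  have "vector_derivative h (at s) = (k1 s / cosh (\<theta> s)) *\<^sub>R vector_derivative c (at s)"
    if s: "s \<in> I" for s
  proof -
    have "k2 s = k1 s / cosh (\<theta> s) * sinh (\<theta> s)"
      using eq s by (simp add: field_simps)
    then show ?thesis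
      using vector_derivative_at[OF frenet(2)[OF s]] vector_derivative_at[OF tangent[OF s]]
      by (simp add: scaleR_add_right)
  qed
  then show "line_of_curvature I h c"
    unfolding line_of_curvature_def by (intro exI ballI)
qed

end

context transversal_surface
begin

lemma cos_angle_nonzero:
  assumes "s \<in> I"
  shows "cos (\<beta> s) \<noteq> 0"
  using angle(2)[OF assms] by (auto simp: cos_zero_iff_int2 field_simps)

text \<open>The \<open>h\<close>-component is \<open>cos (\<beta> s)\<close>. Hence a displacement
  along this direction vanishes only if its parameter does.\<close>

lemma transversal_direction_nonzero:
  assumes s: "s \<in> I"
  shows "transversal_direction h a \<beta> s \<noteq> 0"
proof
  assume "transversal_direction h a \<beta> s = 0"
  then have "minkowski (transversal_direction h a \<beta> s) (h s) = 0"
    by simp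
  then show False
    using cos_angle_nonzero[OF s]
    by (simp add: transversal_direction_def minkowski_bilinear frame_products[OF s])
qed

text \<open>Product rule and Frenet equations: turning the direction by \<open>\<beta>\<close> in
  the plane of \<open>h\<close> and \<open>a\<close> adds \<open>\<beta>'\<close> to the rotation
  rate \<open>k2\<close>.\<close>

lemma vector_derivative_transversal_direction:
  assumes s: "s \<in> I"
  shows "vector_derivative (transversal_direction h a \<beta>) (at s) =
    (k1 s * cos (\<beta> s)) *\<^sub>R q s - ((deriv \<beta> s + k2 s) * sin (\<beta> s)) *\<^sub>R h s
      + ((deriv \<beta> s + k2 s) * cos (\<beta> s)) *\<^sub>R a s"
proof (rule vector_derivative_at)
  note \<beta>' = smooth_on_has_real_derivative[OF smooth_angle s]
  have "(transversal_direction h a \<beta> has_vector_derivative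
      cos (\<beta> s) *\<^sub>R (k1 s *\<^sub>R q s + k2 s *\<^sub>R a s) + (- sin (\<beta> s) * deriv \<beta> s) *\<^sub>R h s
        + (sin (\<beta> s) *\<^sub>R (- k2 s *\<^sub>R h s) + (cos (\<beta> s) * deriv \<beta> s) *\<^sub>R a s)) (at s)"
    unfolding transversal_direction_def [abs_def]
    by (intro has_vector_derivative_add has_vector_derivative_scaleR frenet s
        DERIV_fun_cos DERIV_fun_sin \<beta>')
  then show "(transversal_direction h a \<beta> has_vector_derivative
    (k1 s * cos (\<beta> s)) *\<^sub>R q s - ((deriv \<beta> s + k2 s) * sin (\<beta> s)) *\<^sub>R h s
      + ((deriv \<beta> s + k2 s) * cos (\<beta> s)) *\<^sub>R a s) (at s)"
    by (rule has_vector_derivative_eq_rhs) (simp add: algebra_simps)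
qed

text \<open>The striction parameter is a quotient with nonzero denominator, so only its numerator
  matters, and there the nonzero factor \<open>cos (\<beta> s)\<close> splits off.\<close>

lemma striction_curves_coincide_iff:
  assumes s: "s \<in> I"
  shows "striction_curve c (transversal_direction h a \<beta>) s = c s \<longleftrightarrow>
    sinh (\<theta> s) * (deriv \<beta> s + k2 s) = k1 s * cosh (\<theta> s)"
proof -
  let ?q' = "vector_derivative (transversal_direction h a \<beta>) (at s)"
  have "striction_curve c (transversal_direction h a \<beta>) s = c s \<longleftrightarrow>
      minkowski (vector_derivative c (at s)) ?q' = 0"
    using transversal_direction_nonzero[OF s] direction_derivative_nonnull[OF s]
    by (simp add: striction_curve_def ruled_surface_def striction_parameter_def)
  \<comment> \<open>The \<open>h\<close>-term drops out since \<open>c'\<close> has no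
    \<open>h\<close>-component; the minus sign comes from the timelike \<open>q\<close>.\<close>
  also have "minkowski (vector_derivative c (at s)) ?q' =
      cos (\<beta> s) * (sinh (\<theta> s) * (deriv \<beta> s + k2 s) - k1 s * cosh (\<theta> s))"
    unfolding vector_derivative_transversal_direction[OF s] vector_derivative_at[OF tangent[OF s]]
    by (simp add: minkowski_bilinear frame_products[OF s]) (simp add: algebra_simps)
  finally show ?thesis
    using cos_angle_nonzero[OF s] by simp
qed

end

theorem theorem5p4:
  fixes I :: "real set"
    and c q h a :: "real \<Rightarrow> real ^ 3"
    and k1 k2 \<theta> \<beta> :: "real \<Rightarrow> real"
  assumes N: "timelike_ruled_surface_minus I c q h a k1 k2 \<theta>"
    and N_beta: "transversal_surface I c q h a k1 k2 \<theta> \<beta>"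
    and coincide: "\<forall>s\<in>I. striction_curve c (transversal_direction h a \<beta>) s = c s"
  shows "line_of_curvature I h c \<longleftrightarrow>
    (\<forall>s\<in>I. k2 s \<noteq> 0 \<and> deriv \<beta> s = ((k1 s)\<^sup>2 - (k2 s)\<^sup>2) / k2 s)"
proof -
  interpret transversal_surface I c q h a k1 k2 \<theta> \<beta>
    by (rule N_beta)
  have "k1 s * sinh (\<theta> s) = k2 s * cosh (\<theta> s) \<longleftrightarrow>
      k2 s \<noteq> 0 \<and> deriv \<beta> s = ((k1 s)\<^sup>2 - (k2 s)\<^sup>2) / k2 s" if s: "s \<in> I" for s
  proof -
    have coin: "sinh (\<theta> s) * (deriv \<beta> s + k2 s) = k1 s * cosh (\<theta> s)"
      using coincide s striction_curves_coincide_iff by blast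
    have k1: "k1 s \<noteq> 0"
      by (rule k1_nonzero[OF s])
    have cosh: "cosh (\<theta> s) \<noteq> 0"
      by simp
    have sinh: "sinh (\<theta> s) \<noteq> 0"
      using coin k1 cosh by (metis mult_eq_0_iff)
    \<comment> \<open>Multiplying by \<open>k1 s\<close> produces the term
      \<open>k1 s * cosh (\<theta> s)\<close>, which \<open>coin\<close> replaces by a multiple of
      \<open>sinh (\<theta> s)\<close>.\<close>
    have "k1 s * sinh (\<theta> s) = k2 s * cosh (\<theta> s) \<longleftrightarrow>
        k1 s * (k1 s * sinh (\<theta> s)) = k2 s * (k1 s * cosh (\<theta> s))"
      using k1 by (simp add: mult.left_commute)
    also have "\<dots> \<longleftrightarrow> sinh (\<theta> s) * (k1 s)\<^sup>2 = sinh (\<theta> s) * (k2 s * (deriv \<beta> s + k2 s))"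
      unfolding coin[symmetric] by (simp add: power2_eq_square mult_ac)
    also have "\<dots> \<longleftrightarrow> (k1 s)\<^sup>2 = k2 s * (deriv \<beta> s + k2 s)"
      using sinh by (metis mult_left_cancel)
    \<comment> \<open>From left to right the denominator is nonzero automatically:
      \<open>k2 s = 0\<close> would force \<open>k1 s = 0\<close>.\<close>
    also have "\<dots> \<longleftrightarrow> k2 s \<noteq> 0 \<and> deriv \<beta> s = ((k1 s)\<^sup>2 - (k2 s)\<^sup>2) / k2 s"
      using k1 by (auto simp: field_simps power2_eq_square)
    finally show ?thesis .
  qed
  then show ?thesis
    by (simp add: line_of_curvature_iff)
qed

end
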